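(* Let $p=(12,R)$ be the mesh pattern with $R=\{(0,1),(0,2),(1,0),(1,2),(2,0),(2,1)\}$. Let $F(x)=\sum_{n\ge0}n!\,x^n$, $F(x,q)=\sum_{n\ge 0}x^n\sum_{\pi\in S_n}q^{p(\pi)}$, and $A(x)=\sum_{n\ge0}|S_n(p)|x^n$. Then, as formal power series in $x$, $$A(x)=\frac{(1+2xF(x))F(x)}{(1+xF(x))^2},\qquad F(x,q)=\sum_{i=0}^{\infty}q^{\binom{i}{2}} x^i \left(\frac{F(x)}{1+xF(x)} \right)^{i+1}.$$
   Context: $S_n$ is the set of permutations $\pi=\pi_1\cdots\pi_n$ of $\{1,\dots,n\}$ ($S_0$ contains only the empty permutation). A mesh pattern $(12,R)$ consists of the permutation $12$ and a set $R\subseteq\{0,1,2\}\times\{0,1,2\}$ of shaded boxes. An occurrence of $(12,R)$ in $\pi\in S_n$ is a pair of positions $s<t$ with $\pi_s<\pi_t$ such that, putting $s_0=0,\ s_1=s,\ s_2=t,\ s_3=n+1$ and $v_0=0,\ v_1=\pi_s,\ v_2=\pi_t,\ v_3=n+1$, for every $(i,j)\in R$ there is no position $m$ with $s_i<m<s_{i+1}$ and $v_j<\pi_m<v_{j+1}$. $p(\pi)$ is the number of occurrences of $p$ in $\pi$, and $S_n(p)$ is the set of $\pi\in S_n$ with $p(\pi)=0$ (permutations avoiding $p$). *)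

theory Defs
  imports
    "HOL-Combinatorics.Permutations"
    "HOL-Computational_Algebra.Formal_Power_Series"
    "HOL-Computational_Algebra.Polynomial"
begin

text \<open>
  A permutation in \<open>S_n\<close> is a function \<open>\<pi>\<close> with \<open>\<pi> permutes {1..n}\<close>; its one-line notation is
  \<open>\<pi> 1, \<dots>, \<pi> n\<close>. Such a function is the identity outside \<open>{1..n}\<close>, so distinct functions
  correspond to distinct one-line words.
\<close>

definition perms :: "nat \<Rightarrow> (nat \<Rightarrow> nat) set" where
  "perms n = {\<pi>. \<pi> permutes {1..n}}"

text \<open>
  For an occurrence at positions \<open>s < t\<close>, the grid lines \<open>s_0, \<dots>, s_3\<close> are
  \<open>grid n s t\<close> and the grid lines \<open>v_0, \<dots>, v_3\<close> are \<open>grid n (\<pi> s) (\<pi> t)\<close>.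
\<close>

definition grid :: "nat \<Rightarrow> nat \<Rightarrow> nat \<Rightarrow> nat \<Rightarrow> nat" where
  "grid n a b i = [0, a, b, n + 1] ! i"

definition mesh12_occs :: "(nat \<times> nat) set \<Rightarrow> nat \<Rightarrow> (nat \<Rightarrow> nat) \<Rightarrow> (nat \<times> nat) set" where
  "mesh12_occs R n \<pi> =
    {(s, t). s \<in> {1..n} \<and> t \<in> {1..n} \<and> s < t \<and> \<pi> s < \<pi> t \<and>
      (\<forall>(i, j) \<in> R. \<not> (\<exists>m \<in> {1..n}.
         grid n s t i < m \<and> m < grid n s t (i + 1) \<and>
         grid n (\<pi> s) (\<pi> t) j < \<pi> m \<and> \<pi> m < grid n (\<pi> s) (\<pi> t) (j + 1)))}"

definition mesh12_count :: "(nat \<times> nat) set \<Rightarrow> nat \<Rightarrow> (nat \<Rightarrow> nat) \<Rightarrow> nat" where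
  "mesh12_count R n \<pi> = card (mesh12_occs R n \<pi>)"

definition mesh12_avoiders :: "(nat \<times> nat) set \<Rightarrow> nat \<Rightarrow> (nat \<Rightarrow> nat) set" where
  "mesh12_avoiders R n = {\<pi> \<in> perms n. mesh12_count R n \<pi> = 0}"

definition fact_fps :: "rat fps" where
  "fact_fps = Abs_fps (\<lambda>n. fact n)"

definition avoiders_fps :: "(nat \<times> nat) set \<Rightarrow> rat fps" where
  "avoiders_fps R = Abs_fps (\<lambda>n. of_nat (card (mesh12_avoiders R n)))"

text \<open>
  The bivariate series \<open>F(x, q)\<close> is a power series in \<open>x\<close> whose coefficients are polynomials
  in the indeterminate \<open>q\<close>; \<open>monom 1 k\<close> is \<open>q^k\<close>.
\<close>

definition distribution_fps :: "(nat \<times> nat) set \<Rightarrow> rat poly fps" where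
  "distribution_fps R = Abs_fps (\<lambda>n. \<Sum>\<pi> \<in> perms n. monom 1 (mesh12_count R n \<pi>))"

text \<open>
  The embedding of series in \<open>x\<close> alone into series in \<open>x\<close> over polynomials in \<open>q\<close>. Quotients are
  formed before embedding, since \<open>rat poly\<close> is not a field and its power series have no
  library division.
\<close>

definition fps_const_in_q :: "rat fps \<Rightarrow> rat poly fps" where
  "fps_const_in_q f = Abs_fps (\<lambda>n. [:fps_nth f n:])"

end

theory Submission
  imports Defs
begin

text \<open>
  The three unshaded boxes are the diagonal ones, so a pair \<open>s < t\<close> is an occurrence exactly when
  \<open>\<pi>\<close> is a direct sum \<open>\<alpha> \<oplus> 1 \<oplus> \<beta> \<oplus> 1 \<oplus> \<gamma>\<close> whose two singletons sit at \<open>s\<close> and \<open>t\<close>.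
  This condition separates into one condition on \<open>s\<close> and the same one on \<open>t\<close>: each is a
  strong fixed point, that is, all earlier entries are smaller and all later entries are larger
  (\<open>mesh12_occs_off_diagonal\<close>). Hence a permutation with \<open>k\<close> strong fixed points has
  \<open>k choose 2\<close> occurrences, and only the number of strong fixed points has to be understood.

  Cutting a permutation at its first strong fixed point leaves, on the left, an arbitrary
  permutation without strong fixed points and, on the right, an arbitrary permutation that
  carries the remaining ones (\<open>card_split_first_strong_fixed_point\<close>). Let \<open>C k\<close> be the generating
  function of the permutations with \<open>k\<close> strong fixed points, and \<open>G = C 0\<close>. The cut gives
  \<open>C (k + 1) = x G (C k)\<close>, so \<open>C k = x^k G^(k+1)\<close>; without control of the right part it gives
  \<open>F = G + x G F\<close>, so \<open>G = F / (1 + x F)\<close>. Then \<open>F(x, q)\<close> is the sum of the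
  \<open>q^(k choose 2) (C k)\<close>, and the avoiders, for which \<open>k \<le> 1\<close>, are counted by \<open>G + x G^2\<close>.
\<close>

section \<open>Occurrences as pairs of strong fixed points\<close>

text \<open>
  The fixed point property itself is not demanded: for a permutation it follows by counting
  (\<open>strong_fixed_points_iff\<close>). The relational form below is what the shading of a mesh pattern
  expresses.
\<close>

definition strong_fixed_points :: "nat \<Rightarrow> (nat \<Rightarrow> nat) \<Rightarrow> nat set" where
  "strong_fixed_points n \<pi> = {s \<in> {1..n}. \<forall>m \<in> {1..n}. m < s \<longleftrightarrow> \<pi> m < \<pi> s}"

lemma strong_fixed_points_subset: "strong_fixed_points n \<pi> \<subseteq> {1..n}"
  by (auto simp: strong_fixed_points_def)

lemma finite_strong_fixed_points [simp]: "finite (strong_fixed_points n \<pi>)"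
  by (rule finite_subset[OF strong_fixed_points_subset]) simp

lemma finite_perms [simp]: "finite (perms n)"
  by (simp add: perms_def finite_permutations)

lemma card_perms: "card (perms n) = fact n"
  by (simp add: perms_def card_permutations)

lemma perms_iff:
  "\<pi> \<in> perms n \<longleftrightarrow>
    inj_on \<pi> {1..n} \<and> \<pi> ` {1..n} \<subseteq> {1..n} \<and> (\<forall>m. m \<notin> {1..n} \<longrightarrow> \<pi> m = m)"
proof
  assume "\<pi> \<in> perms n"
  then have "\<pi> permutes {1..n}"
    by (simp add: perms_def)
  then show "inj_on \<pi> {1..n} \<and> \<pi> ` {1..n} \<subseteq> {1..n} \<and> (\<forall>m. m \<notin> {1..n} \<longrightarrow> \<pi> m = m)"
    by (metis permutes_inj_on permutes_image permutes_not_in order_refl)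
next
  assume *: "inj_on \<pi> {1..n} \<and> \<pi> ` {1..n} \<subseteq> {1..n} \<and> (\<forall>m. m \<notin> {1..n} \<longrightarrow> \<pi> m = m)"
  then have "bij_betw \<pi> {1..n} {1..n}"
    by (simp add: bij_betw_def endo_inj_surj)
  with * show "\<pi> \<in> perms n"
    by (auto simp: perms_def intro!: bij_imp_permutes)
qed

lemma perms_in_range: "\<pi> \<in> perms n \<Longrightarrow> \<pi> m \<in> {1..n} \<longleftrightarrow> m \<in> {1..n}"
  unfolding perms_def by (simp only: mem_Collect_eq permutes_in_image)

lemma perms_eq_iff: "\<pi> \<in> perms n \<Longrightarrow> \<pi> x = \<pi> y \<longleftrightarrow> x = y"
  unfolding perms_def by (auto dest: permutes_inj simp: inj_eq)

text \<open>
  A permutation maps the positions before \<open>s\<close> onto the values below \<open>\<pi> s\<close>; comparing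
  the sizes \<open>s - 1\<close> and \<open>\<pi> s - 1\<close> of these sets forces \<open>\<pi> s = s\<close>.
\<close>

lemma strong_fixed_points_iff:
  assumes "\<pi> \<in> perms n"
  shows "s \<in> strong_fixed_points n \<pi> \<longleftrightarrow>
    s \<in> {1..n} \<and> \<pi> s = s \<and> (\<forall>m \<in> {1..n}. m < s \<longleftrightarrow> \<pi> m < s)"
proof
  assume s: "s \<in> strong_fixed_points n \<pi>"
  then have s': "s \<in> {1..n}" "\<And>m. m \<in> {1..n} \<Longrightarrow> m < s \<longleftrightarrow> \<pi> m < \<pi> s"
    by (auto simp: strong_fixed_points_def)
  have img: "\<pi> ` {1..n} = {1..n}"
    using assms by (simp add: perms_def permutes_image)
  have \<pi>s: "\<pi> s \<in> {1..n}"
    using s' img by blast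
  have eq: "\<pi> ` {1..<s} = {1..<\<pi> s}"
  proof (intro equalityI subsetI)
    fix v assume "v \<in> \<pi> ` {1..<s}"
    then obtain m where m: "m \<in> {1..<s}" "v = \<pi> m" by auto
    then have "m \<in> {1..n}" using s' by auto
    then show "v \<in> {1..<\<pi> s}" using m s'(2)[of m] img by auto
  next
    fix v assume v: "v \<in> {1..<\<pi> s}"
    then have "v \<in> \<pi> ` {1..n}" using \<pi>s img by auto
    then obtain m where m: "m \<in> {1..n}" "v = \<pi> m" by auto
    then show "v \<in> \<pi> ` {1..<s}" using v s'(2)[of m] by auto
  qed
  have "card (\<pi> ` {1..<s}) = card {1..<s}"
    using assms by (intro card_image) (auto simp: inj_on_def perms_eq_iff)
  then have "\<pi> s = s"
    using eq s'(1) \<pi>s by auto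
  then show "s \<in> {1..n} \<and> \<pi> s = s \<and> (\<forall>m \<in> {1..n}. m < s \<longleftrightarrow> \<pi> m < s)"
    using s' by simp
qed (auto simp: strong_fixed_points_def)

text \<open>
  Increasing pairs correspond to two-element subsets.
\<close>

lemma card_increasing_pairs:
  fixes S :: "nat set"
  assumes "finite S"
  shows "card {(s, t). s \<in> S \<and> t \<in> S \<and> s < t} = card S choose 2"
proof -
  have "bij_betw (\<lambda>(s, t). {s, t}) {(s, t). s \<in> S \<and> t \<in> S \<and> s < t} {B. B \<subseteq> S \<and> card B = 2}"
  proof (rule bij_betw_imageI)
    show "inj_on (\<lambda>(s, t). {s, t}) {(s, t). s \<in> S \<and> t \<in> S \<and> s < t}"
      by (auto simp: inj_on_def doubleton_eq_iff)
    have "B \<in> (\<lambda>(s, t). {s, t}) ` {(s, t). s \<in> S \<and> t \<in> S \<and> s < t}"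
      if "B \<subseteq> S" "card B = 2" for B
    proof -
      from that obtain x y where "B = {x, y}" "x \<noteq> y" by (auto simp: card_2_iff)
      then have "B = {min x y, max x y}" "min x y < max x y" "min x y \<in> S" "max x y \<in> S"
        using that by (auto simp: min_def max_def)
      then show ?thesis by (intro image_eqI[of _ _ "(min x y, max x y)"]) auto
    qed
    then show "(\<lambda>(s, t). {s, t}) ` {(s, t). s \<in> S \<and> t \<in> S \<and> s < t} = {B. B \<subseteq> S \<and> card B = 2}"
      by auto
  qed
  then show ?thesis
    using bij_betw_same_card n_subsets[OF assms, of 2] by fastforce
qed

abbreviation off_diagonal :: "(nat \<times> nat) set" where
  "off_diagonal \<equiv> {(0,1), (0,2), (1,0), (1,2), (2,0), (2,1)}"

text \<open>
  For a fixed position \<open>m\<close>, to lie in none of the six off-diagonal boxes means to lie in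
  a column and a row of the same index, and that index is determined by comparing with \<open>s\<close> and with
  \<open>t\<close>. Entries on the grid lines satisfy both sides, since \<open>\<pi>\<close> is injective.
\<close>

lemma mesh12_occs_off_diagonal:
  assumes "\<pi> \<in> perms n"
  shows "mesh12_occs off_diagonal n \<pi> =
    {(s, t). s \<in> strong_fixed_points n \<pi> \<and> t \<in> strong_fixed_points n \<pi> \<and> s < t}"
proof -
  have "(s, t) \<in> mesh12_occs off_diagonal n \<pi> \<longleftrightarrow>
      s \<in> strong_fixed_points n \<pi> \<and> t \<in> strong_fixed_points n \<pi> \<and> s < t" for s t
  proof (cases "s \<in> {1..n} \<and> t \<in> {1..n} \<and> s < t \<and> \<pi> s < \<pi> t")
    case True
    let ?clear = "\<lambda>m. \<not> (0 < m \<and> m < s \<and> \<pi> s < \<pi> m \<and> \<pi> m < \<pi> t) \<and>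
       \<not> (0 < m \<and> m < s \<and> \<pi> t < \<pi> m \<and> \<pi> m < n + 1) \<and>
       \<not> (s < m \<and> m < t \<and> 0 < \<pi> m \<and> \<pi> m < \<pi> s) \<and>
       \<not> (s < m \<and> m < t \<and> \<pi> t < \<pi> m \<and> \<pi> m < n + 1) \<and>
       \<not> (t < m \<and> m < n + 1 \<and> 0 < \<pi> m \<and> \<pi> m < \<pi> s) \<and>
       \<not> (t < m \<and> m < n + 1 \<and> \<pi> s < \<pi> m \<and> \<pi> m < \<pi> t)"
    have pw: "?clear m
       \<longleftrightarrow> (m < s \<longleftrightarrow> \<pi> m < \<pi> s) \<and> (m < t \<longleftrightarrow> \<pi> m < \<pi> t)" if "m \<in> {1..n}" for m
    proof -
      have "\<pi> m \<in> {1..n}" using that perms_in_range[OF assms] by blast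
      then have "0 < \<pi> m" "\<pi> m < n + 1" "0 < m" "m < n + 1"
        using that by auto
      moreover have "\<pi> m = \<pi> s \<longleftrightarrow> m = s" "\<pi> m = \<pi> t \<longleftrightarrow> m = t"
        using perms_eq_iff[OF assms] by auto
      ultimately show ?thesis using True
        by (cases "m < s"; cases "m = s"; cases "m < t"; cases "m = t") auto
    qed
    have "(s, t) \<in> mesh12_occs off_diagonal n \<pi> \<longleftrightarrow> (\<forall>m \<in> {1..n}. ?clear m)"
      unfolding mesh12_occs_def using True
      by (simp add: grid_def eval_nat_numeral ball_conj_distrib)
         (intro conj_cong ball_cong refl; auto)
    also have "\<dots> \<longleftrightarrow>
      (\<forall>m \<in> {1..n}. (m < s \<longleftrightarrow> \<pi> m < \<pi> s) \<and> (m < t \<longleftrightarrow> \<pi> m < \<pi> t))"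
      by (intro ball_cong refl) (rule pw)
    finally show ?thesis using True by (auto simp: strong_fixed_points_def)
  qed (auto simp: mesh12_occs_def strong_fixed_points_def)
  then show ?thesis by auto
qed

lemma mesh12_count_off_diagonal:
  assumes "\<pi> \<in> perms n"
  shows "mesh12_count off_diagonal n \<pi> = card (strong_fixed_points n \<pi>) choose 2"
  unfolding mesh12_count_def mesh12_occs_off_diagonal[OF assms]
  by (rule card_increasing_pairs) simp

section \<open>Splitting a permutation at a strong fixed point\<close>

text \<open>
  For \<open>\<alpha> \<in> perms (s - 1)\<close> and \<open>\<beta>\<close> a permutation, this is the direct sum
  \<open>\<alpha> \<oplus> 1 \<oplus> \<beta>\<close>. The singleton at position \<open>s\<close> needs no case of its own because
  permutations fix \<open>0\<close>, so that position \<open>s\<close> receives \<open>s + \<beta> 0 = s\<close>.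
\<close>

definition glue_at :: "nat \<Rightarrow> (nat \<Rightarrow> nat) \<times> (nat \<Rightarrow> nat) \<Rightarrow> nat \<Rightarrow> nat" where
  "glue_at s = (\<lambda>(\<alpha>, \<beta>) m. if m < s then \<alpha> m else s + \<beta> (m - s))"

text \<open>
  A strong fixed point at position \<open>a + 1\<close> means that the \<open>a\<close> positions before it and the \<open>b\<close>
  positions after it are permuted separately, so the two parts can be chosen freely.
\<close>

lemma bij_betw_glue_at:
  "bij_betw (glue_at (Suc a)) (perms a \<times> perms b)
    {\<pi> \<in> perms (Suc (a + b)). Suc a \<in> strong_fixed_points (Suc (a + b)) \<pi>}"
proof -
  define s n where "s = Suc a" and "n = Suc (a + b)"
  (* The right part is shifted down by s. Since s is fixed, it sends 0 to 0, as a permutation must. *)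
  define unglue :: "(nat \<Rightarrow> nat) \<Rightarrow> (nat \<Rightarrow> nat) \<times> (nat \<Rightarrow> nat)" where
    "unglue \<pi> = (\<lambda>m. if m < s then \<pi> m else m, \<lambda>m. \<pi> (m + s) - s)" for \<pi>
  have "bij_betw (glue_at s) (perms a \<times> perms b) {\<pi> \<in> perms n. s \<in> strong_fixed_points n \<pi>}"
  proof (rule bij_betw_byWitness[where f' = unglue])
    have low: "\<alpha> m < s \<longleftrightarrow> m < s" "\<alpha> 0 = 0" "s \<le> m \<Longrightarrow> \<alpha> m = m" 
      if "\<alpha> \<in> perms a" for \<alpha> m
    proof -
      show "\<alpha> 0 = 0" "s \<le> m \<Longrightarrow> \<alpha> m = m"
        using that by (auto simp: perms_iff s_def)
      then show "\<alpha> m < s \<longleftrightarrow> m < s"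
        using perms_in_range[OF that, of m] by (cases "m = 0") (auto simp: s_def)
    qed
    have zero: "\<beta> 0 = 0" if "\<beta> \<in> perms b" for \<beta>
      using that by (auto simp: perms_iff)
    show "\<forall>p \<in> perms a \<times> perms b. unglue (glue_at s p) = p"
      by (auto simp: unglue_def glue_at_def fun_eq_iff low)
    have high: "\<pi> s = s" "\<pi> 0 = 0" "\<pi> m < s \<longleftrightarrow> m < s" "n < m \<Longrightarrow> \<pi> m = m"
      if "\<pi> \<in> perms n" "s \<in> strong_fixed_points n \<pi>" for \<pi> m
    proof -
      show "\<pi> s = s" "\<pi> 0 = 0" "n < m \<Longrightarrow> \<pi> m = m"
        using that by (auto simp: perms_iff strong_fixed_points_iff[OF that(1)])
      note ends = this
      have "m < s \<longleftrightarrow> \<pi> m < s" if "m \<in> {1..n}"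
        using \<open>s \<in> strong_fixed_points n \<pi>\<close> that
        unfolding strong_fixed_points_iff[OF \<open>\<pi> \<in> perms n\<close>] by blast
      moreover have "m = 0 \<or> m \<in> {1..n} \<or> n < m" by auto
      ultimately show "\<pi> m < s \<longleftrightarrow> m < s"
        using ends(2,3) by (auto simp: s_def)
    qed
    show "\<forall>\<pi> \<in> {\<pi> \<in> perms n. s \<in> strong_fixed_points n \<pi>}. glue_at s (unglue \<pi>) = \<pi>"
    proof
      fix \<pi> assume "\<pi> \<in> {\<pi> \<in> perms n. s \<in> strong_fixed_points n \<pi>}"
      then have \<pi>: "\<pi> \<in> perms n" "s \<in> strong_fixed_points n \<pi>" by auto
      have "s \<le> \<pi> m" if "s \<le> m" for m
        using high(3)[OF \<pi>, of m] that by linarith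
      then show "glue_at s (unglue \<pi>) = \<pi>"
        by (auto simp: unglue_def glue_at_def fun_eq_iff)
    qed
    show "glue_at s ` (perms a \<times> perms b) \<subseteq> {\<pi> \<in> perms n. s \<in> strong_fixed_points n \<pi>}"
    proof safe
      fix \<alpha> \<beta> assume \<alpha>: "\<alpha> \<in> perms a" and \<beta>: "\<beta> \<in> perms b"
      let ?\<pi> = "glue_at s (\<alpha>, \<beta>)"
      have lt: "?\<pi> m < s \<longleftrightarrow> m < s" for m
        using low(1)[OF \<alpha>] by (simp add: glue_at_def)
      show "?\<pi> \<in> perms n"
        unfolding perms_iff
      proof (intro conjI allI impI)
        show "inj_on ?\<pi> {1..n}"
        proof (rule inj_onI)
          fix x y assume "?\<pi> x = ?\<pi> y"
          then have "x < s \<longleftrightarrow> y < s" "?\<pi> x = ?\<pi> y" using lt[of x] lt[of y] by auto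
          then show "x = y"
            by (cases "x < s") (auto simp: glue_at_def perms_eq_iff[OF \<alpha>] perms_eq_iff[OF \<beta>])
        qed
        have "?\<pi> m \<in> {1..n}" if "m \<in> {1..n}" for m
        proof (cases "m < s")
          case True
          then show ?thesis using that perms_in_range[OF \<alpha>, of m]
            by (auto simp: glue_at_def s_def n_def)
        next
          case False
          then show ?thesis using that perms_in_range[OF \<beta>, of "m - s"] zero[OF \<beta>]
            by (cases "m = s") (auto simp: glue_at_def s_def n_def)
        qed
        then show "?\<pi> ` {1..n} \<subseteq> {1..n}" by blast
        fix m assume "m \<notin> {1..n}"
        then have "m = 0 \<or> m > n" by auto
        then show "?\<pi> m = m"
        proof
          assume "m > n"
          then have "m - s \<notin> {1..b}" "m > s" by (auto simp: s_def n_def)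
          then have "\<beta> (m - s) = m - s" using \<beta> unfolding perms_iff by blast
          then show ?thesis using \<open>m > s\<close> by (simp add: glue_at_def)
        qed (use low(2)[OF \<alpha>] in \<open>simp add: glue_at_def s_def\<close>)
      qed
      then show "s \<in> strong_fixed_points n ?\<pi>"
        using lt zero[OF \<beta>] by (auto simp: strong_fixed_points_iff glue_at_def s_def n_def)
    qed
    show "unglue ` {\<pi> \<in> perms n. s \<in> strong_fixed_points n \<pi>} \<subseteq> perms a \<times> perms b"
    proof safe
      fix \<pi> \<alpha> \<beta>
      assume \<pi>: "\<pi> \<in> perms n" "s \<in> strong_fixed_points n \<pi>"
        and "(\<alpha>, \<beta>) = unglue \<pi>"
      then have \<alpha>: "\<alpha> = (\<lambda>m. if m < s then \<pi> m else m)" and \<beta>: "\<beta> = (\<lambda>m. \<pi> (m + s) - s)"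
        by (simp_all add: unglue_def)
      note h = high[OF \<pi>]
      have pos: "0 < \<pi> m" if "0 < m" for m
        using perms_eq_iff[OF \<pi>(1), of m 0] h(2) that by auto
      show "\<alpha> \<in> perms a"
        unfolding perms_iff \<alpha>
      proof (intro conjI allI impI)
        show "inj_on (\<lambda>m. if m < s then \<pi> m else m) {1..a}"
          by (auto simp: inj_on_def s_def perms_eq_iff[OF \<pi>(1)])
        show "(\<lambda>m. if m < s then \<pi> m else m) ` {1..a} \<subseteq> {1..a}"
          using h(3) pos by (auto simp: s_def less_Suc_eq_le Suc_le_eq)
        show "(if m < s then \<pi> m else m) = m" if "m \<notin> {1..a}" for m
          using that h(2) by (cases "m = 0") (auto simp: s_def)
      qed
      have ge: "s \<le> \<pi> (m + s)" for m
        using h(3)[of "m + s"] by linarith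
      have ne: "\<pi> (m + s) \<noteq> s" if "0 < m" for m
        using perms_eq_iff[OF \<pi>(1), of "m + s" s] h(1) that by auto
      have le: "\<pi> (m + s) \<le> n" if "m \<le> b" for m
        using perms_in_range[OF \<pi>(1), of "m + s"] that by (auto simp: s_def n_def)
      show "\<beta> \<in> perms b"
        unfolding perms_iff \<beta>
      proof (intro conjI allI impI)
        show "inj_on (\<lambda>m. \<pi> (m + s) - s) {1..b}"
        proof (rule inj_onI)
          fix x y assume "\<pi> (x + s) - s = \<pi> (y + s) - s"
          then have "\<pi> (x + s) = \<pi> (y + s)" using ge[of x] ge[of y] by linarith
          then show "x = y" using perms_eq_iff[OF \<pi>(1)] by simp
        qed
        have "\<pi> (m + s) - s \<in> {1..b}" if "m \<in> {1..b}" for m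
          using that ge[of m] ne[of m] le[of m] by (auto simp: s_def n_def)
        then show "(\<lambda>m. \<pi> (m + s) - s) ` {1..b} \<subseteq> {1..b}" by blast
        show "\<pi> (m + s) - s = m" if "m \<notin> {1..b}" for m
          using that h(1) h(4)[of "m + s"] by (cases "m = 0") (auto simp: s_def n_def)
      qed
    qed
  qed
  then show ?thesis by (simp add: s_def n_def)
qed

text \<open>
  Entries on opposite sides of the cut compare like their positions, so they never obstruct
  each other, and being a strong fixed point is decided inside each part.
\<close>

lemma strong_fixed_points_glue_at:
  assumes \<alpha>: "\<alpha> \<in> perms a" and \<beta>: "\<beta> \<in> perms b"
  shows "strong_fixed_points (Suc (a + b)) (glue_at (Suc a) (\<alpha>, \<beta>)) =
    strong_fixed_points a \<alpha> \<union> {Suc a} \<union> (+) (Suc a) ` strong_fixed_points b \<beta>"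
proof -
  define s n \<pi> where "s = Suc a" and "n = Suc (a + b)" and "\<pi> = glue_at s (\<alpha>, \<beta>)"
  have \<pi>: "\<pi> \<in> perms n" "s \<in> strong_fixed_points n \<pi>"
    using bij_betw_apply[OF bij_betw_glue_at[of a b], of "(\<alpha>, \<beta>)"] \<alpha> \<beta>
    by (auto simp: s_def n_def \<pi>_def)
  have \<beta>0: "\<beta> 0 = 0"
    using \<beta> by (auto simp: perms_iff)
  have lo: "\<pi> m = \<alpha> m" if "m < s" for m
    using that by (simp add: \<pi>_def glue_at_def)
  have hi: "\<pi> (s + m) = s + \<beta> m" for m
    by (simp add: \<pi>_def glue_at_def)
  have lt: "\<pi> m < s \<longleftrightarrow> m < s" if "m \<in> {1..n}" for m
    using \<pi>(2) that unfolding strong_fixed_points_iff[OF \<pi>(1)] by blast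
  have low: "x \<in> strong_fixed_points n \<pi> \<longleftrightarrow> x \<in> strong_fixed_points a \<alpha>" if "x < s" for x
  proof (cases "x \<in> {1..a}")
    case True
    have xn: "x \<in> {1..n}" using True by (auto simp: n_def)
    have \<pi>x: "\<pi> x < s" using lt[OF xn] that by simp
    have "(\<forall>m \<in> {1..n}. m < x \<longleftrightarrow> \<pi> m < \<pi> x) \<longleftrightarrow> (\<forall>m \<in> {1..a}. m < x \<longleftrightarrow> \<alpha> m < \<alpha> x)"
    proof
      assume "\<forall>m \<in> {1..n}. m < x \<longleftrightarrow> \<pi> m < \<pi> x"
      then show "\<forall>m \<in> {1..a}. m < x \<longleftrightarrow> \<alpha> m < \<alpha> x"
        using lo that by (auto simp: s_def n_def)
    next
      assume *: "\<forall>m \<in> {1..a}. m < x \<longleftrightarrow> \<alpha> m < \<alpha> x"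
      show "\<forall>m \<in> {1..n}. m < x \<longleftrightarrow> \<pi> m < \<pi> x"
      proof
        fix m assume m: "m \<in> {1..n}"
        show "m < x \<longleftrightarrow> \<pi> m < \<pi> x"
        proof (cases "m < s")
          case True
          then show ?thesis using * m that lo by (auto simp: s_def)
        next
          case False
          then show ?thesis using lt[OF m] \<pi>x that by linarith
        qed
      qed
    qed
    then show ?thesis using True xn by (simp add: strong_fixed_points_def)
  qed (use that in \<open>auto simp: strong_fixed_points_def s_def\<close>)
  have high: "s + x \<in> strong_fixed_points n \<pi> \<longleftrightarrow> x \<in> strong_fixed_points b \<beta>" if "0 < x" for x
  proof (cases "x \<in> {1..b}")
    case True
    have xn: "s + x \<in> {1..n}" using True by (auto simp: n_def s_def)
    have \<beta>x: "0 < \<beta> x"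
      using perms_in_range[OF \<beta>, of x] True by auto
    have "(\<forall>m \<in> {1..n}. m < s + x \<longleftrightarrow> \<pi> m < \<pi> (s + x)) \<longleftrightarrow> (\<forall>m \<in> {1..b}. m < x \<longleftrightarrow> \<beta> m < \<beta> x)"
    proof
      assume *: "\<forall>m \<in> {1..n}. m < s + x \<longleftrightarrow> \<pi> m < \<pi> (s + x)"
      show "\<forall>m \<in> {1..b}. m < x \<longleftrightarrow> \<beta> m < \<beta> x"
      proof
        fix m assume "m \<in> {1..b}"
        then have "s + m \<in> {1..n}" by (auto simp: n_def s_def)
        with * show "m < x \<longleftrightarrow> \<beta> m < \<beta> x" by (fastforce simp: hi)
      qed
    next
      assume *: "\<forall>m \<in> {1..b}. m < x \<longleftrightarrow> \<beta> m < \<beta> x"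
      show "\<forall>m \<in> {1..n}. m < s + x \<longleftrightarrow> \<pi> m < \<pi> (s + x)"
      proof
        fix m assume m: "m \<in> {1..n}"
        show "m < s + x \<longleftrightarrow> \<pi> m < \<pi> (s + x)"
        proof (cases "m < s")
          case True
          then show ?thesis using lt[OF m] by (simp add: hi)
        next
          case False
          then obtain k where k: "m = s + k" by (metis le_add_diff_inverse not_less)
          then have "k = 0 \<or> k \<in> {1..b}" using m by (auto simp: n_def s_def)
          then show ?thesis using * \<beta>x \<beta>0 that by (auto simp: k hi)
        qed
      qed
    qed
    then show ?thesis using True xn by (simp add: strong_fixed_points_def)
  qed (use that in \<open>auto simp: strong_fixed_points_def s_def n_def\<close>)
  have "strong_fixed_points n \<pi> =
      strong_fixed_points a \<alpha> \<union> {s} \<union> (+) s ` strong_fixed_points b \<beta>"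
  proof (rule set_eqI)
    fix y
    consider "y < s" | "y = s" | x where "y = s + x" "0 < x"
      by (metis less_imp_add_positive linorder_neqE_nat)
    then show "y \<in> strong_fixed_points n \<pi> \<longleftrightarrow>
        y \<in> strong_fixed_points a \<alpha> \<union> {s} \<union> (+) s ` strong_fixed_points b \<beta>"
    proof cases
      case 1
      then show ?thesis using low by auto
    next
      case 2
      then show ?thesis using \<pi>(2) by simp
    next
      case 3
      have "y \<notin> strong_fixed_points a \<alpha>"
        using 3 strong_fixed_points_subset[of a \<alpha>] by (auto simp: s_def)
      then show ?thesis using 3 high by auto
    qed
  qed
  then show ?thesis by (simp add: s_def n_def \<pi>_def)
qed

text \<open>
  The cut is at the \<^emph>\<open>first\<close> strong fixed point exactly when the left part has none. The predicate
  \<open>P\<close> on the number of later ones allows both the refined count (\<open>P\<close> selects one number) and the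
  total count (\<open>P\<close> always true).
\<close>

lemma card_first_strong_fixed_point:
  "card {\<pi> \<in> perms (Suc (a + b)).
      (Suc a \<in> strong_fixed_points (Suc (a + b)) \<pi> \<and>
       (\<forall>x \<in> strong_fixed_points (Suc (a + b)) \<pi>. Suc a \<le> x)) \<and>
      P (card (strong_fixed_points (Suc (a + b)) \<pi>) - 1)} =
    card {\<alpha> \<in> perms a. strong_fixed_points a \<alpha> = {}} *
    card {\<beta> \<in> perms b. P (card (strong_fixed_points b \<beta>))}"
proof -
  let ?n = "Suc (a + b)"
  have iff: "((\<forall>x \<in> strong_fixed_points ?n (glue_at (Suc a) p). Suc a \<le> x) \<and>
        P (card (strong_fixed_points ?n (glue_at (Suc a) p)) - 1)) \<longleftrightarrow>
      (strong_fixed_points a (fst p) = {} \<and> P (card (strong_fixed_points b (snd p))))"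
    if "p \<in> perms a \<times> perms b" for p
  proof -
    obtain \<alpha> \<beta> where "p = (\<alpha>, \<beta>)"
      by (cases p)
    with that have p: "p = (\<alpha>, \<beta>)" "\<alpha> \<in> perms a" "\<beta> \<in> perms b"
      by auto
    have sub: "strong_fixed_points a \<alpha> \<subseteq> {1..a}" "strong_fixed_points b \<beta> \<subseteq> {1..b}"
      by (rule strong_fixed_points_subset)+
    have first: "(\<forall>x \<in> strong_fixed_points ?n (glue_at (Suc a) p). Suc a \<le> x) \<longleftrightarrow>
        strong_fixed_points a \<alpha> = {}"
    proof -
      have "(\<forall>x \<in> A \<union> {Suc a} \<union> (+) (Suc a) ` B. Suc a \<le> x) \<longleftrightarrow> A = {}"
        if "A \<subseteq> {1..a}" for A B :: "nat set"
        using that by (auto simp: ball_Un subset_iff) (metis not_less_eq_eq)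
      then show ?thesis
        unfolding p(1) strong_fixed_points_glue_at[OF p(2,3)] using sub(1) by blast
    qed
    have "card (strong_fixed_points ?n (glue_at (Suc a) p)) - 1 = card (strong_fixed_points b \<beta>)"
      if "strong_fixed_points a \<alpha> = {}"
    proof -
      have "Suc a \<notin> (+) (Suc a) ` strong_fixed_points b \<beta>"
        using sub by auto
      then show ?thesis
        using that by (simp add: p strong_fixed_points_glue_at card_image inj_on_def)
    qed
    with first show ?thesis by (auto simp: p)
  qed
  have "bij_betw (glue_at (Suc a))
      {p \<in> perms a \<times> perms b.
        strong_fixed_points a (fst p) = {} \<and> P (card (strong_fixed_points b (snd p)))}
      {\<pi> \<in> {\<pi> \<in> perms ?n. Suc a \<in> strong_fixed_points ?n \<pi>}.
        (\<forall>x \<in> strong_fixed_points ?n \<pi>. Suc a \<le> x) \<and> P (card (strong_fixed_points ?n \<pi>) - 1)}"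
    by (rule bij_betw_Collect[OF bij_betw_glue_at]) (use iff in blast)
  from bij_betw_same_card[OF this]
  have "card {\<pi> \<in> perms ?n. (Suc a \<in> strong_fixed_points ?n \<pi> \<and>
        (\<forall>x \<in> strong_fixed_points ?n \<pi>. Suc a \<le> x)) \<and> P (card (strong_fixed_points ?n \<pi>) - 1)} =
      card {p \<in> perms a \<times> perms b.
        strong_fixed_points a (fst p) = {} \<and> P (card (strong_fixed_points b (snd p)))}"
    by (simp add: conj_assoc)
  also have "{p \<in> perms a \<times> perms b.
        strong_fixed_points a (fst p) = {} \<and> P (card (strong_fixed_points b (snd p)))} =
      {\<alpha> \<in> perms a. strong_fixed_points a \<alpha> = {}} \<times>
      {\<beta> \<in> perms b. P (card (strong_fixed_points b \<beta>))}"
    by auto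
  finally show ?thesis by (simp add: card_cartesian_product)
qed

text \<open>
  The first strong fixed point is unique, so summing over its position counts each permutation
  with at least one strong fixed point once.
\<close>

lemma card_split_first_strong_fixed_point:
  "card {\<pi> \<in> perms (Suc n). strong_fixed_points (Suc n) \<pi> \<noteq> {} \<and>
      P (card (strong_fixed_points (Suc n) \<pi>) - 1)} =
    (\<Sum>a \<le> n. card {\<alpha> \<in> perms a. strong_fixed_points a \<alpha> = {}} *
      card {\<beta> \<in> perms (n - a). P (card (strong_fixed_points (n - a) \<beta>))})"
proof -
  define B where "B a = {\<pi> \<in> perms (Suc n).
      (Suc a \<in> strong_fixed_points (Suc n) \<pi> \<and>
       (\<forall>x \<in> strong_fixed_points (Suc n) \<pi>. Suc a \<le> x)) \<and>
      P (card (strong_fixed_points (Suc n) \<pi>) - 1)}" for a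
  have "{\<pi> \<in> perms (Suc n). strong_fixed_points (Suc n) \<pi> \<noteq> {} \<and>
      P (card (strong_fixed_points (Suc n) \<pi>) - 1)} = (\<Union>a \<le> n. B a)"
  proof (intro equalityI subsetI)
    fix \<pi>
    assume \<pi>: "\<pi> \<in> {\<pi> \<in> perms (Suc n). strong_fixed_points (Suc n) \<pi> \<noteq> {} \<and>
      P (card (strong_fixed_points (Suc n) \<pi>) - 1)}"
    let ?S = "strong_fixed_points (Suc n) \<pi>"
    have m: "Min ?S \<in> ?S" using \<pi> by simp
    then have "Min ?S \<in> {1..Suc n}" using strong_fixed_points_subset by blast
    then obtain a where a: "Min ?S = Suc a" "a \<le> n" by (cases "Min ?S") auto
    have "\<forall>x \<in> ?S. Suc a \<le> x" using a(1) by (metis Min_le finite_strong_fixed_points)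
    then have "\<pi> \<in> B a" using \<pi> m a by (simp add: B_def)
    then show "\<pi> \<in> (\<Union>a \<le> n. B a)" using a by blast
  qed (auto simp: B_def)
  moreover have "card (\<Union>a \<le> n. B a) = (\<Sum>a \<le> n. card (B a))"
  proof (rule card_UN_disjoint)
    show "\<forall>a \<in> {..n}. \<forall>a' \<in> {..n}. a \<noteq> a' \<longrightarrow> B a \<inter> B a' = {}"
    proof (intro ballI impI)
      fix a a' :: nat assume "a \<noteq> a'"
      have "a = a'" if "\<pi> \<in> B a" "\<pi> \<in> B a'" for \<pi>
      proof -
        have "Suc a \<le> Suc a'" "Suc a' \<le> Suc a"
          using that unfolding B_def by blast+
        then show ?thesis by simp
      qed
      with \<open>a \<noteq> a'\<close> show "B a \<inter> B a' = {}" by blast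
    qed
  qed (auto simp: B_def)
  moreover have "card (B a) = card {\<alpha> \<in> perms a. strong_fixed_points a \<alpha> = {}} *
      card {\<beta> \<in> perms (n - a). P (card (strong_fixed_points (n - a) \<beta>))}" if "a \<le> n" for a
    using card_first_strong_fixed_point[of a "n - a" P] that by (simp add: B_def)
  ultimately show ?thesis by simp
qed

section \<open>Generating functions\<close>

unbundle fps_syntax

definition count_fps :: "nat \<Rightarrow> rat fps" where
  "count_fps k = Abs_fps (\<lambda>n. of_nat (card {\<pi> \<in> perms n. card (strong_fixed_points n \<pi>) = k}))"

lemma fps_X_mult_mult_nth_Suc: "(fps_X * (f * g)) $ Suc n = (\<Sum>a \<le> n. f $ a * g $ (n - a))"
  for f g :: "'a :: comm_ring_1 fps"
  unfolding fps_X_mult_nth by (simp add: fps_mult_nth atLeast0AtMost)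

text \<open>
  The factor \<open>x\<close> marks the first strong fixed point, \<open>count_fps 0\<close> the part before it and
  \<open>count_fps k\<close> the part after it.
\<close>

lemma count_fps_Suc: "count_fps (Suc k) = fps_X * (count_fps 0 * count_fps k)"
proof (rule fps_ext)
  fix n
  show "count_fps (Suc k) $ n = (fps_X * (count_fps 0 * count_fps k)) $ n"
  proof (cases n)
    case 0
    have "strong_fixed_points 0 \<pi> = {}" for \<pi>
      by (simp add: strong_fixed_points_def)
    then show ?thesis by (simp add: count_fps_def 0)
  next
    case (Suc m)
    have "card S = Suc k \<longleftrightarrow> S \<noteq> {} \<and> card S - 1 = k" if "finite S" for S :: "nat set"
      using that by (cases "card S") auto
    then have "{\<pi> \<in> perms n. card (strong_fixed_points n \<pi>) = Suc k} =
        {\<pi> \<in> perms n. strong_fixed_points n \<pi> \<noteq> {} \<and> card (strong_fixed_points n \<pi>) - 1 = k}"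
      by (simp only: finite_strong_fixed_points)
    then show ?thesis
      using card_split_first_strong_fixed_point[of m "\<lambda>j. j = k"]
      unfolding Suc fps_X_mult_mult_nth_Suc by (simp add: count_fps_def)
  qed
qed

text \<open>
  The same cut with no restriction on the part after the first strong fixed point; the first
  summand collects the permutations that cannot be cut.
\<close>

lemma fact_fps_eq: "fact_fps = count_fps 0 + fps_X * (count_fps 0 * fact_fps)"
proof (rule fps_ext)
  fix n
  show "fact_fps $ n = (count_fps 0 + fps_X * (count_fps 0 * fact_fps)) $ n"
  proof (cases n)
    case 0
    have "strong_fixed_points 0 \<pi> = {}" for \<pi>
      by (simp add: strong_fixed_points_def)
    then show ?thesis by (simp add: count_fps_def fact_fps_def 0 card_perms)
  next
    case (Suc m)
    have "perms n = {\<pi> \<in> perms n. strong_fixed_points n \<pi> = {}} \<union>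
        {\<pi> \<in> perms n. strong_fixed_points n \<pi> \<noteq> {}}"
      by auto
    then have "card (perms n) = card {\<pi> \<in> perms n. strong_fixed_points n \<pi> = {}} +
        card {\<pi> \<in> perms n. strong_fixed_points n \<pi> \<noteq> {}}"
      by (subst card_Un_disjoint[symmetric]) auto
    then have "fact n = card {\<pi> \<in> perms n. strong_fixed_points n \<pi> = {}} +
        (\<Sum>a \<le> m. card {\<alpha> \<in> perms a. strong_fixed_points a \<alpha> = {}} * fact (m - a))"
      using card_split_first_strong_fixed_point[of m "\<lambda>_. True"] by (simp add: card_perms Suc)
    then have "(fact n :: rat) = of_nat (card {\<pi> \<in> perms n. strong_fixed_points n \<pi> = {}} +
        (\<Sum>a \<le> m. card {\<alpha> \<in> perms a. strong_fixed_points a \<alpha> = {}} * fact (m - a)))"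
      by (metis of_nat_fact)
    then show ?thesis
      unfolding Suc fps_add_nth fps_X_mult_mult_nth_Suc
      by (simp add: count_fps_def fact_fps_def del: fact_Suc)
  qed
qed

lemma count_fps_power: "count_fps k = fps_X ^ k * count_fps 0 ^ (k + 1)"
  by (induction k) (simp_all add: count_fps_Suc mult_ac)

lemma one_plus_X_mult_fact_fps: "(1 + fps_X * fact_fps) * count_fps 0 = fact_fps"
  using fact_fps_eq by (simp add: algebra_simps)

lemma count_fps_0: "count_fps 0 = fact_fps / (1 + fps_X * fact_fps)"
proof -
  have "1 + fps_X * fact_fps \<noteq> (0 :: rat fps)"
    by (auto simp: fps_eq_iff intro!: exI[of _ 0])
  then show ?thesis
    by (metis one_plus_X_mult_fact_fps nonzero_mult_div_cancel_left)
qed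

text \<open>
  \<open>k choose 2\<close> vanishes exactly for \<open>k \<le> 1\<close>.
\<close>

lemma avoiders_fps_off_diagonal:
  "avoiders_fps off_diagonal = count_fps 0 + count_fps 1"
proof (rule fps_ext)
  fix n
  let ?A = "\<lambda>k. {\<pi> \<in> perms n. card (strong_fixed_points n \<pi>) = k}"
  have "k choose 2 = 0 \<longleftrightarrow> k = 0 \<or> k = 1" for k :: nat
    by (auto simp: binomial_eq_0_iff)
  then have "mesh12_count off_diagonal n \<pi> = 0 \<longleftrightarrow>
      card (strong_fixed_points n \<pi>) = 0 \<or> card (strong_fixed_points n \<pi>) = 1"
    if "\<pi> \<in> perms n" for \<pi>
    by (simp only: mesh12_count_off_diagonal[OF that])
  then have "mesh12_avoiders off_diagonal n = ?A 0 \<union> ?A 1"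
    unfolding mesh12_avoiders_def by blast
  moreover have "card (?A 0 \<union> ?A 1) = card (?A 0) + card (?A 1)"
    by (rule card_Un_disjoint) auto
  ultimately have "card (mesh12_avoiders off_diagonal n) = card (?A 0) + card (?A 1)"
    by (simp only:)
  then show "avoiders_fps off_diagonal $ n = (count_fps 0 + count_fps 1) $ n"
    by (simp only: avoiders_fps_def count_fps_def fps_add_nth fps_nth_Abs_fps of_nat_add)
qed

text \<open>
  A permutation in \<open>S_n\<close> has at most \<open>n\<close> strong fixed points, so the coefficient of \<open>x^n\<close> is already
  reached by every partial sum up to some \<open>N \<ge> n\<close>. This stabilisation is what makes the
  infinite sum converge.
\<close>

lemma distribution_fps_off_diagonal_nth:
  assumes "n \<le> N"
  shows "distribution_fps off_diagonal $ n = (\<Sum>k \<le> N. monom 1 (k choose 2) * [:count_fps k $ n:])"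
proof -
  have "card (strong_fixed_points n \<pi>) \<le> N" for \<pi>
    using card_mono[OF _ strong_fixed_points_subset, of n \<pi>] assms by simp
  then have sub: "(\<lambda>\<pi>. card (strong_fixed_points n \<pi>)) ` perms n \<subseteq> {..N}"
    by auto
  have "distribution_fps off_diagonal $ n =
      (\<Sum>\<pi> \<in> perms n. monom 1 (card (strong_fixed_points n \<pi>) choose 2))"
    unfolding distribution_fps_def fps_nth_Abs_fps
    by (intro sum.cong refl) (simp only: mesh12_count_off_diagonal)
  also have "\<dots> = (\<Sum>k \<le> N. \<Sum>\<pi> \<in> {\<pi> \<in> perms n. card (strong_fixed_points n \<pi>) = k}.
      monom 1 (card (strong_fixed_points n \<pi>) choose 2))"
    by (rule sum.group[symmetric]) (use sub in auto)
  also have "\<dots> = (\<Sum>k \<le> N. monom 1 (k choose 2) * [:count_fps k $ n:])"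
    by (intro sum.cong) (simp_all add: count_fps_def of_nat_poly mult.commute)
  finally show ?thesis .
qed

lemma fps_const_in_q_mult: "fps_const_in_q (f * g) = fps_const_in_q f * fps_const_in_q g"
proof (rule fps_ext)
  fix n
  have "[:sum h A:] = (\<Sum>i \<in> A. [:h i:])" for h :: "nat \<Rightarrow> rat" and A
    using sum_comp_morphism[of "\<lambda>x :: rat. [:x:]" h A] by (simp add: o_def)
  then show "fps_const_in_q (f * g) $ n = (fps_const_in_q f * fps_const_in_q g) $ n"
    by (simp add: fps_const_in_q_def fps_mult_nth mult.commute)
qed

lemma fps_const_in_q_X: "fps_const_in_q fps_X = fps_X"
  by (rule fps_ext) (simp add: fps_const_in_q_def fps_X_def one_pCons)

lemma fps_const_in_q_power: "fps_const_in_q (f ^ k) = fps_const_in_q f ^ k"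
proof (induction k)
  case 0
  show ?case by (rule fps_ext) (simp add: fps_const_in_q_def one_pCons)
qed (simp add: fps_const_in_q_mult)

theorem theorem3p6:
  fixes R :: "(nat \<times> nat) set" and F :: "rat fps"
  defines "R \<equiv> {(0,1), (0,2), (1,0), (1,2), (2,0), (2,1)}"
    and "F \<equiv> fact_fps"
  shows "avoiders_fps R = (1 + 2 * fps_X * F) * F / (1 + fps_X * F) ^ 2 \<and>
    (\<lambda>i. fps_const (monom 1 (i choose 2)) * fps_X ^ i *
          fps_const_in_q (F / (1 + fps_X * F)) ^ (i + 1))
      sums distribution_fps R"
proof
  let ?D = "1 + fps_X * F"
  let ?G = "count_fps 0"
  have DG: "?D * ?G = F"
    unfolding F_def by (rule one_plus_X_mult_fact_fps)
  have D: "?D ^ 2 \<noteq> 0"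
    by (auto simp: fps_eq_iff intro!: exI[of _ 0])
  (* Multiply G + x G^2 by D^2 and pair each G with a factor D, using D G = F. *)
  have "?D ^ 2 * avoiders_fps R = ?D * (?D * ?G) + fps_X * (?D * ?G) * (?D * ?G)"
    unfolding R_def avoiders_fps_off_diagonal using count_fps_power[of 1]
    by (simp add: power2_eq_square algebra_simps)
  also have "\<dots> = (1 + 2 * fps_X * F) * F"
    unfolding DG by (simp add: algebra_simps)
  finally show "avoiders_fps R = (1 + 2 * fps_X * F) * F / ?D ^ 2"
    by (metis D nonzero_mult_div_cancel_left)
next
  have summand: "fps_const (monom 1 (i choose 2)) * fps_X ^ i *
      fps_const_in_q (F / (1 + fps_X * F)) ^ (i + 1) =
      fps_const (monom 1 (i choose 2)) * fps_const_in_q (count_fps i)" for i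
    using count_fps_power[of i]
    by (simp add: F_def count_fps_0[symmetric] fps_const_in_q_mult fps_const_in_q_power
        fps_const_in_q_X mult.assoc)
  have "(\<lambda>i. fps_const (monom 1 (i choose 2)) * fps_const_in_q (count_fps i))
      sums distribution_fps R"
    unfolding sums_def'
  proof (rule tendsto_fpsI)
    fix n
    have "(\<Sum>i = 0..N. fps_const (monom 1 (i choose 2)) * fps_const_in_q (count_fps i)) $ n =
        distribution_fps R $ n" if "n \<le> N" for N
      unfolding R_def distribution_fps_off_diagonal_nth[OF that]
      by (simp add: fps_sum_nth fps_const_in_q_def atLeast0AtMost)
    then show "\<forall>\<^sub>F N in sequentially.
        (\<Sum>i = 0..N. fps_const (monom 1 (i choose 2)) * fps_const_in_q (count_fps i)) $ n =
        distribution_fps R $ n"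
      by (rule eventually_sequentiallyI)
  qed
  then show "(\<lambda>i. fps_const (monom 1 (i choose 2)) * fps_X ^ i *
      fps_const_in_q (F / (1 + fps_X * F)) ^ (i + 1)) sums distribution_fps R"
    unfolding summand .
qed

end
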